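(* Let $n\ge0$ be an integer, $\varrho>-1$, $\Upsilon$ a positive integer, $w\in\mathbb{C}$, $X\ne0$. For $\mathrm{Re}(q)>0$ with $\left|\frac{w^\Upsilon}{q^\Upsilon}\right|<1$, the Laplace transform in $Y$ is $$\mathbb{L}\left[Y^{\varrho}\,{}_{\Upsilon}H_n^{\varrho}(X,wY)\right](q)=\frac{(2X)^n}{q^{\varrho+1}}\left[\frac{q^\Upsilon-w^\Upsilon}{q^\Upsilon}\right]^{n}{}_2F_0\left[\frac{-n}{2},\frac{-n+1}{2};-;\frac{-q^\Upsilon}{X^2(q^\Upsilon-w^\Upsilon)}\right].$$
   Context: $(a)_k$ is the Pochhammer symbol and $[\cdot]$ the integer part. The 2D Hermite–Konhauser polynomials are $${}_{\Upsilon}H_n^{\varrho}(X,Y)=\sum_{s=0}^{[n/2]}\sum_{r=0}^{n-s}\frac{(-1)^s(-n)_{2s}(-n)_{s+r}}{(-n)_s\,\Gamma(\varrho+1+\Upsilon r)\,s!\,r!}(2X)^{n-2s}Y^{\Upsilon r}.$$ $\mathbb{L}[f](q)=\int_0^\infty e^{-qY}f(Y)\,dY$ and ${}_2F_0(a,b;-;x)=\sum_{k\ge0}(a)_k(b)_k\,x^k/k!$ (a finite sum here). *)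

theory Defs
  imports "HOL-Analysis.Analysis"
begin

text \<open>
  The parameter \<open>m\<close> is the Konhauser parameter \<open>\<Upsilon>\<close>. The denominator \<open>(-n)_s\<close> does not vanish
  for \<open>s \<le> n div 2\<close>, and for \<open>\<rho> > -1\<close> the Gamma factor is taken at a positive real.
\<close>

definition hermite_konhauser :: "nat \<Rightarrow> nat \<Rightarrow> real \<Rightarrow> complex \<Rightarrow> complex \<Rightarrow> complex" where
  "hermite_konhauser m n \<rho> X Y =
     (\<Sum>s=0..n div 2. \<Sum>r=0..n - s.
        ((-1) ^ s * pochhammer (- of_nat n) (2 * s) * pochhammer (- of_nat n) (s + r)) /
        (pochhammer (- of_nat n) s * of_real (Gamma (\<rho> + 1 + real m * real r)) * fact s * fact r)
        * (2 * X) ^ (n - 2 * s) * Y ^ (m * r))"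

text \<open>
  The series has radius of convergence 0 in general, in which case \<open>suminf\<close> is meaningless; it is
  a finite sum as soon as \<open>a\<close> or \<open>b\<close> is a nonpositive integer.
\<close>

definition hyp_2F0 :: "complex \<Rightarrow> complex \<Rightarrow> complex \<Rightarrow> complex" where
  "hyp_2F0 a b x = (\<Sum>k. pochhammer a k * pochhammer b k * x ^ k / fact k)"

definition laplace_integrable :: "(real \<Rightarrow> complex) \<Rightarrow> complex \<Rightarrow> bool" where
  "laplace_integrable f q \<longleftrightarrow>
     set_integrable lborel {0..} (\<lambda>Y. exp (- q * of_real Y) * f Y)"

definition laplace :: "(real \<Rightarrow> complex) \<Rightarrow> complex \<Rightarrow> complex" where
  "laplace f q = (LINT Y:{0..}|lborel. exp (- q * of_real Y) * f Y)"

end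

theory Submission
  imports Defs
begin

text \<open>
  For complex \<open>q\<close> with positive real part, the Laplace transform \<open>\<Gamma>(a) / q\<^sup>a\<close> of \<open>t\<^bsup>a-1\<^esup>\<close> is obtained
  from the case of a large real \<open>c\<close>: expand \<open>e\<^bsup>-qt\<^esup> = e\<^bsup>-ct\<^esup> e\<^bsup>(c-q)t\<^esup>\<close> in powers of \<open>c - q\<close>, integrate
  termwise and sum the resulting binomial series, which converges because \<open>\<bar>c - q\<bar> < c\<close>.
  Applied to the polynomial, this cancels the Gamma factors. Since \<open>(-n)\<^sub>s\<^sub>+\<^sub>r = (-n)\<^sub>s (-(n-s))\<^sub>r\<close>, the
  inner sum is then the binomial expansion of \<open>(1 - w\<^sup>m/q\<^sup>m)\<^bsup>n-s\<^esup>\<close>, and the duplication formula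
  \<open>(-n)\<^sub>2\<^sub>s = 4\<^sup>s (-n/2)\<^sub>s ((-n+1)/2)\<^sub>s\<close> identifies the outer sum.
\<close>

text \<open>Euler's integral after the substitution \<open>t\<close> to \<open>c * t\<close>. The
  integrand is nonnegative, so its \<open>nn_integral\<close> already yields Bochner
  integrability.\<close>

lemma has_bochner_integral_Gamma_real:
  fixes a c :: real
  assumes a: "a > 0" and c: "c > 0"
  shows "has_bochner_integral lborel
           (\<lambda>t. indicator {0..} t * (t powr (a - 1) * exp (- c * t))) (Gamma a / c powr a)"
proof -
  have "has_bochner_integral lborel
          (\<lambda>t. indicator {0..} t * (t powr (a - 1) * exp (- t))) (Gamma a)"
  proof (rule has_bochner_integral_nn_integral)
    show "(\<integral>\<^sup>+t. ennreal (indicator {0..} t * (t powr (a - 1) * exp (- t))) \<partial>lborel)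
            = ennreal (Gamma a)"
      using Gamma_conv_nn_integral_real[OF a] by (simp add: exp_minus field_simps)
  qed (use a Gamma_real_pos[of a] in auto)
  hence "has_bochner_integral lborel
          (\<lambda>t. indicator {0..} (0 + c * t) * ((0 + c * t) powr (a - 1) * exp (- (0 + c * t))))
          (Gamma a /\<^sub>R \<bar>c\<bar>)"
    using c by (subst (asm) lborel_has_bochner_integral_real_affine_iff[where t = 0 and c = c]) auto
  \<comment> \<open>The factor \<open>c powr (1 - a)\<close> removes the power of \<open>c\<close>
    that the substitution put into \<open>(c * t) powr (a - 1)\<close>.\<close>
  hence "has_bochner_integral lborel
          (\<lambda>t. c powr (1 - a) *
             (indicator {0..} (0 + c * t) * ((0 + c * t) powr (a - 1) * exp (- (0 + c * t)))))
          (c powr (1 - a) * (Gamma a /\<^sub>R \<bar>c\<bar>))"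
    by (intro has_bochner_integral_mult_right)
  also have "(\<lambda>t. c powr (1 - a) *
             (indicator {0..} (0 + c * t) * ((0 + c * t) powr (a - 1) * exp (- (0 + c * t)))))
      = (\<lambda>t. indicator {0..} t * (t powr (a - 1) * exp (- c * t)))"
    using c by (auto simp: fun_eq_iff indicator_def powr_mult zero_le_mult_iff powr_diff)
  also have "c powr (1 - a) * (Gamma a /\<^sub>R \<bar>c\<bar>) = Gamma a / c powr a"
    using c by (simp add: powr_diff field_simps)
  finally show ?thesis .
qed

lemma Gamma_add_of_nat_real:
  fixes a :: real
  assumes "a > 0"
  shows "Gamma (a + real k) = Gamma a * pochhammer a k"
  proof -
  have "a \<notin> \<int>\<^sub>\<le>\<^sub>0" using assms by (auto elim!: nonpos_Ints_cases)
  thus ?thesis using pochhammer_Gamma[of a k] Gamma_real_pos[OF assms] by simp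
qed

text \<open>Serves both for the binomial series with exponent \<open>- a\<close> and, at
  \<open>a = - of_nat N\<close>, for the finite binomial theorem.\<close>

lemma gbinomial_uminus_mult_power_uminus:
  fixes a x :: "'a :: field_char_0"
  shows "((- a) gchoose k) * (- x) ^ k = pochhammer a k * x ^ k / fact k"
  by (simp add: gbinomial_pochhammer power_minus[of x])

lemma has_bochner_integral_Gamma_complex:
  fixes a :: real and q :: complex
  assumes a: "a > 0" and q: "Re q > 0"
  shows "has_bochner_integral lborel
           (\<lambda>t. indicator {0..} t *\<^sub>R (exp (- q * of_real t) * of_real (t powr (a - 1))))
           (of_real (Gamma a) / q powr of_real a)"
proof -
  \<comment> \<open>any \<open>c\<close> above half this value ensures \<open>cmod (c - q) < c\<close>\<close>
  define c where "c = (cmod q)\<^sup>2 / Re q"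
  have "q \<noteq> 0" using q by auto
  hence c: "c > 0" using q by (simp add: c_def)
  define d where "d = of_real c - q"
  have dc: "cmod d < c"
  proof -
    have "(cmod d)\<^sup>2 = c\<^sup>2 - 2 * c * Re q + (cmod q)\<^sup>2"
      unfolding cmod_power2 by (simp add: d_def power2_eq_square algebra_simps)
    also have "\<dots> = c\<^sup>2 - (cmod q)\<^sup>2"
      using q by (simp add: c_def)
    also have "\<dots> < c\<^sup>2" using q by auto
    finally show ?thesis using c by (simp add: power_less_imp_less_base)
  qed
  \<comment> \<open>\<open>F k\<close> is the \<open>k\<close>-th term of the expansion in powers of
    \<open>d\<close>. The factor \<open>t ^ k\<close> is absorbed into the exponent, so that
    \<open>G k\<close> is a real Gamma integrand with parameter \<open>a + real k\<close>.\<close>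
  define G where "G = (\<lambda>k t. indicator {0..} t * (t powr (a + real k - 1) * exp (- c * t)))"
  define F where "F = (\<lambda>k t. complex_of_real (G k t) * (d ^ k / fact k))"
  have G: "has_bochner_integral lborel (G k) (Gamma a * pochhammer a k / (c powr a * c ^ k))" for k
    using has_bochner_integral_Gamma_real[of "a + real k" c] a c
    by (simp add: G_def Gamma_add_of_nat_real powr_add powr_realpow)
  have F: "has_bochner_integral lborel (F k)
             (of_real (Gamma a * pochhammer a k / (c powr a * c ^ k)) * (d ^ k / fact k))" for k
    unfolding F_def by (intro has_bochner_integral_mult_left has_bochner_integral_of_real G)
  have nF: "norm (F k t) = G k t * (cmod d ^ k / fact k)" for k t
    by (simp add: F_def G_def norm_mult norm_divide norm_power)
  have F_sums: "(\<lambda>k. F k t) sums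
      (indicator {0..} t *\<^sub>R (exp (- q * of_real t) * of_real (t powr (a - 1))))"
    and nF_summable: "summable (\<lambda>k. norm (F k t))" for t
  proof -
    have *: "F k t = (indicator {0..} t * t powr (a - 1) * exp (- c * t)) *\<^sub>R ((d * of_real t) ^ k /\<^sub>R fact k)" for k
    proof (cases "t > 0")
      case True
      hence "t powr (a + real k - 1) = t powr (a - 1) * t ^ k"
        by (simp add: powr_add powr_diff powr_realpow)
      thus ?thesis using True
        by (simp add: F_def G_def scaleR_conv_of_real power_mult_distrib field_simps)
    next
      case False
      \<comment> \<open>At \<open>t = 0\<close> both sides vanish because
        \<open>0 powr x = 0\<close> for every \<open>x\<close>, including
        \<open>x = 0\<close>.\<close>
      thus ?thesis by (cases "t = 0") (auto simp: F_def G_def)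
    qed
    have e: "(indicator {0..} t * t powr (a - 1) * exp (- c * t)) *\<^sub>R exp (d * of_real t)
       = indicator {0..} t *\<^sub>R (exp (- q * of_real t) * of_real (t powr (a - 1)))"
      by (simp add: d_def scaleR_conv_of_real exp_of_real [symmetric] exp_add [symmetric]
          exp_diff exp_minus field_simps)
    show "(\<lambda>k. F k t) sums
      (indicator {0..} t *\<^sub>R (exp (- q * of_real t) * of_real (t powr (a - 1))))"
      unfolding * e [symmetric] by (intro sums_scaleR_right exp_converges)
    show "summable (\<lambda>k. norm (F k t))"
      unfolding * norm_scaleR[of "_ * _"]
      by (intro summable_mult summable_norm_exp)
  qed
  \<comment> \<open>The integrals of the terms and of their norms are terms of the same binomial
    series, at \<open>- (d / c)\<close> and at \<open>- (cmod d / c)\<close>: hence a complex and a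
    real version.\<close>
  have coeff: "Gamma a * pochhammer a k / (c powr a * c ^ k) * (x ^ k / fact k)
     = Gamma a / c powr a * (((- a) gchoose k) * (- (x / c)) ^ k)" for k x
    unfolding gbinomial_uminus_mult_power_uminus by (simp add: power_divide)
  have coeffC: "of_real (Gamma a * pochhammer a k / (c powr a * c ^ k)) * (z ^ k / fact k)
     = of_real (Gamma a / c powr a) * (((- of_real a) gchoose k) * (- (z / of_real c)) ^ k)"
    for k and z :: complex
    unfolding gbinomial_uminus_mult_power_uminus by (simp add: power_divide pochhammer_of_real mult_ac)
  \<comment> \<open>Summability of the norm integrals justifies integrating termwise; it holds
    because \<open>cmod d / c < 1\<close>.\<close>
  have summ: "summable (\<lambda>k. integral\<^sup>L lborel (\<lambda>t. norm (F k t)))"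
  proof -
    have "integral\<^sup>L lborel (\<lambda>t. norm (F k t))
            = Gamma a / c powr a * (((- a) gchoose k) * (- (cmod d / c)) ^ k)" for k
      unfolding nF coeff [symmetric]
      by (intro has_bochner_integral_integral_eq has_bochner_integral_mult_left G)
    moreover have "summable (\<lambda>k. ((- a) gchoose k) * (- (cmod d / c)) ^ k)"
      using gen_binomial_real[of "- (cmod d / c)" "- a"] dc c by (auto simp: sums_iff)
    ultimately show ?thesis by (simp add: summable_mult)
  qed
  have int: "integrable lborel (F k)" for k using F[of k] by (simp add: has_bochner_integral_iff)
  have lim: "(\<Sum>k. F k t) =
      indicator {0..} t *\<^sub>R (exp (- q * of_real t) * of_real (t powr (a - 1)))" for t
    using F_sums[of t] by (simp add: sums_iff)
  have I: "integrable lborel (\<lambda>t. \<Sum>k. F k t)"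
    by (rule integrable_suminf[OF int _ summ]) (use nF_summable in auto)
  have S: "(\<lambda>k. integral\<^sup>L lborel (F k)) sums (\<integral>t. (\<Sum>k. F k t) \<partial>lborel)"
    by (rule sums_integral[OF int _ summ]) (use nF_summable in auto)
  have val: "integral\<^sup>L lborel (F k) =
      of_real (Gamma a / c powr a) * (((- of_real a) gchoose k) * (- (d / of_real c)) ^ k)" for k
    using F[of k] unfolding coeffC by (simp add: has_bochner_integral_iff)
  have "(\<lambda>k. integral\<^sup>L lborel (F k)) sums
      (of_real (Gamma a / c powr a) * (1 + (- (d / of_real c))) powr (- of_real a))"
    unfolding val using dc c
    by (intro sums_mult gen_binomial_complex) (auto simp: norm_divide)
  also have "1 + (- (d / of_real c)) = of_real (1 / c) * q"
    using c by (simp add: d_def field_simps)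
  \<comment> \<open>Complex \<open>powr\<close> is not multiplicative in general; a positive real
    factor such as \<open>1 / c\<close> leaves the argument of \<open>q\<close> unchanged and can be
    split off.\<close>
  also have "(of_real (1 / c) * q) powr (- of_real a)
      = of_real (c powr a) * q powr (- of_real a)"
  proof -
    have "of_real (1 / c) powr (- of_real a :: complex) = of_real ((1 / c) powr (- a))"
      using c by (subst powr_of_real [symmetric]) auto
    also have "(1 / c) powr (- a) = c powr a"
      using c by (simp add: powr_divide powr_minus field_simps)
    finally show ?thesis using c by (subst powr_times_real_left) auto
  qed
  also have "of_real (Gamma a / c powr a) * (of_real (c powr a) * q powr (- of_real a))
      = of_real (Gamma a) / q powr of_real a"
    using c by (simp add: powr_minus field_simps)
  finally have "(\<integral>t. (\<Sum>k. F k t) \<partial>lborel) = of_real (Gamma a) / q powr of_real a"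
    using S sums_unique2 by blast
  with I show ?thesis unfolding lim by (simp add: has_bochner_integral_iff)
qed

text \<open>The binomial theorem, since \<open>pochhammer (- of_nat N) r / fact r\<close> is the
  binomial coefficient up to the sign \<open>(-1) ^ r\<close>.\<close>

lemma sum_pochhammer_neg_of_nat:
  fixes z :: "'a :: field_char_0"
  shows "(\<Sum>r=0..N. pochhammer (- of_nat N) r / fact r * z ^ r) = (1 - z) ^ N"
proof -
  have "(1 - z) ^ N = (- z + 1) ^ N" by simp
  also have "\<dots> = (\<Sum>r=0..N. of_nat (N choose r) * (- z) ^ r)"
    by (subst binomial_ring) (simp add: atMost_atLeast0)
  also have "\<dots> = (\<Sum>r=0..N. pochhammer (- of_nat N) r / fact r * z ^ r)"
    using gbinomial_uminus_mult_power_uminus[of "- of_nat N" _ z]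
    by (simp add: binomial_gbinomial)
  finally show ?thesis ..
qed

lemma pochhammer_neg_double:
  "pochhammer (- of_nat n :: 'a :: field_char_0) (2 * s) =
     4 ^ s * pochhammer (- of_nat n / 2) s * pochhammer ((- of_nat n + 1) / 2) s"
proof -
  have "- of_nat n / 2 + 1 / 2 = (- of_nat n + 1) / (2 :: 'a)"
    by (simp only: add_divide_distrib)
  moreover have "2 * (- of_nat n / 2) = (- of_nat n :: 'a)"
    by simp
  moreover have "of_nat (2 ^ (2 * s)) = (4 ^ s :: 'a)"
    by (simp add: power_mult)
  ultimately show ?thesis
    using pochhammer_double[of "- of_nat n / 2 :: 'a" s] by (simp only:)
qed

text \<open>The duplication formula merges the two parameters and turns \<open>x\<close> into
  \<open>x / 4\<close>. The series stops because \<open>pochhammer (- of_nat n) (2 * s)\<close>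
  vanishes for \<open>2 * s > n\<close>.\<close>

lemma hyp_2F0_neg_of_nat:
  "hyp_2F0 (- of_nat n / 2) ((- of_nat n + 1) / 2) x =
     (\<Sum>s=0..n div 2. pochhammer (- of_nat n) (2 * s) * (x / 4) ^ s / fact s)"
proof -
  have "pochhammer (- of_nat n / 2) s * pochhammer ((- of_nat n + 1) / 2) s * x ^ s / fact s
     = pochhammer (- of_nat n) (2 * s) * (x / 4) ^ s / fact s" for s
    by (simp add: pochhammer_neg_double power_divide)
  hence "hyp_2F0 (- of_nat n / 2) ((- of_nat n + 1) / 2) x =
      (\<Sum>s. pochhammer (- of_nat n) (2 * s) * (x / 4) ^ s / fact s)"
    by (simp add: hyp_2F0_def)
  also have "\<dots> = (\<Sum>s=0..n div 2. pochhammer (- of_nat n) (2 * s) * (x / 4) ^ s / fact s)"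
    by (rule suminf_finite) (auto simp: pochhammer_of_nat_eq_0_iff)
  finally show ?thesis .
qed

theorem corollary4:
  fixes n m :: nat and \<rho> :: real and w X q :: complex
  assumes "\<rho> > -1"
    and "m > 0"
    and "X \<noteq> 0"
    and "Re q > 0"
    and "norm (w ^ m / q ^ m) < 1"
  defines "f \<equiv> (\<lambda>Y::real. of_real (Y powr \<rho>) * hermite_konhauser m n \<rho> X (w * of_real Y))"
  shows "laplace_integrable f q \<and>
    laplace f q =
      (2 * X) ^ n / q powr (of_real \<rho> + 1) * ((q ^ m - w ^ m) / q ^ m) ^ n *
      hyp_2F0 (- of_nat n / 2) ((- of_nat n + 1) / 2) (- (q ^ m) / (X\<^sup>2 * (q ^ m - w ^ m)))"
proof -
  define p where "p = q powr (of_real \<rho> + 1)"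
  define z where "z = w ^ m / q ^ m"
  define A where "A = (\<lambda>s r. ((-1) ^ s * pochhammer (- of_nat n) (2 * s) * pochhammer (- of_nat n) (s + r)) /
        (pochhammer (- of_nat n) s * fact s * fact r) * (2 * X) ^ (n - 2 * s) :: complex)"
  define g where "g = (\<lambda>r. of_real (Gamma (\<rho> + 1 + real m * real r)) :: complex)"
  define h where "h = (\<lambda>r t. indicator {0..} t *\<^sub>R
        (exp (- q * of_real t) * of_real (t powr (\<rho> + 1 + real m * real r - 1))))"
  have q0: "q \<noteq> 0" using assms by auto
  \<comment> \<open>\<open>norm z < 1\<close> excludes \<open>z = 1\<close>, which allows division
    by powers of \<open>1 - z\<close>.\<close>
  have z1: "1 - z \<noteq> 0" using assms by (auto simp: z_def)
  have pos: "\<rho> + 1 + real m * real r > 0" for r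
  proof -
    have "real m * real r \<ge> 0" by simp
    thus ?thesis using assms(1) by linarith
  qed
  have g0: "g r \<noteq> 0" for r
    using Gamma_real_pos[OF pos[of r]] unfolding g_def by (metis of_real_eq_0_iff less_irrefl)
  have h: "has_bochner_integral lborel (h r) (g r / (p * q ^ (m * r)))" for r
  proof -
    have "q powr of_real (\<rho> + 1 + real m * real r) = p * q powr of_nat (m * r)"
      unfolding p_def by (subst powr_add [symmetric]) simp
    also have "q powr of_nat (m * r) = q ^ (m * r)"
      using q0 by (subst powr_nat') auto
    finally show ?thesis
      using has_bochner_integral_Gamma_complex[OF pos[of r] assms(4)] by (simp only: h_def g_def)
  qed
  have integrand: "indicator {0..} t *\<^sub>R (exp (- q * of_real t) * f t) =
      (\<Sum>s=0..n div 2. \<Sum>r=0..n - s. A s r * w ^ (m * r) / g r * h r t)" for t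
  proof -
    have *: "indicator {0..} t *\<^sub>R (exp (- q * of_real t) * (of_real (t powr \<rho>) * (of_real t) ^ (m * r))) = h r t" for r
    proof (cases "t > 0")
      case True
      hence "t powr (\<rho> + 1 + real m * real r - 1) = t powr \<rho> * t ^ (m * r)"
        by (simp add: powr_add powr_realpow flip: of_nat_mult)
      thus ?thesis by (simp add: h_def)
    next
      case False
      \<comment> \<open>Again \<open>0 powr x = 0\<close> settles \<open>t = 0\<close>, even when
        \<rho> is \<open>0\<close>.\<close>
      thus ?thesis by (cases "t = 0") (auto simp: h_def)
    qed
    show ?thesis
      unfolding f_def hermite_konhauser_def sum_distrib_left scaleR_sum_right * [symmetric]
      by (intro sum.cong refl) (simp add: A_def g_def scaleR_conv_of_real power_mult_distrib mult_ac)
  qed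
  have main: "has_bochner_integral lborel (\<lambda>t. indicator {0..} t *\<^sub>R (exp (- q * of_real t) * f t))
     (\<Sum>s=0..n div 2. \<Sum>r=0..n - s. A s r * w ^ (m * r) / g r * (g r / (p * q ^ (m * r))))"
    unfolding integrand
    by (intro has_bochner_integral_sum has_bochner_integral_mult_right h)
  have "(\<Sum>r=0..n - s. A s r * w ^ (m * r) / g r * (g r / (p * q ^ (m * r)))) =
      (2 * X) ^ n / p * (1 - z) ^ n *
      (pochhammer (- of_nat n) (2 * s) * (- 1 / (X\<^sup>2 * (1 - z)) / 4) ^ s / fact s)"
    if s: "s \<in> {0..n div 2}" for s
  proof -
    have s2: "2 * s \<le> n" "s \<le> n" using s by auto
    have ps: "pochhammer (- of_nat n :: complex) s \<noteq> 0"
      using s2 by (simp add: pochhammer_of_nat_eq_0_iff)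
    have shift: "pochhammer (- of_nat n :: complex) (s + r) =
       pochhammer (- of_nat n) s * pochhammer (- of_nat (n - s)) r" for r
      using s2 by (simp add: pochhammer_product' of_nat_diff)
    \<comment> \<open>\<open>?K\<close> collects the factors independent of \<open>r\<close> that
      remain once \<open>g r\<close> and \<open>pochhammer (- of_nat n) s\<close> cancel.\<close>
    let ?K = "(-1) ^ s * pochhammer (- of_nat n) (2 * s) / fact s * (2 * X) ^ (n - 2 * s) / p"
    have "(\<Sum>r=0..n - s. A s r * w ^ (m * r) / g r * (g r / (p * q ^ (m * r)))) =
       (\<Sum>r=0..n - s. ?K * (pochhammer (- of_nat (n - s)) r / fact r * z ^ r))"
      using ps g0 by (intro sum.cong refl)
        (simp add: A_def shift z_def power_divide mult_ac flip: power_mult)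
    also have "\<dots> = ?K * (1 - z) ^ (n - s)"
      by (simp only: sum_pochhammer_neg_of_nat flip: sum_distrib_left)
    \<comment> \<open>Powers independent of \<open>s\<close> are split off; what remains to the
      power \<open>s\<close> forms the argument of the hypergeometric sum.\<close>
    also have "(2 * X) ^ (n - 2 * s) = (2 * X) ^ n / (4 * X\<^sup>2) ^ s"
      using s2 assms(3) by (simp add: power_diff power_mult power_mult_distrib)
    also have "(1 - z) ^ (n - s) = (1 - z) ^ n / (1 - z) ^ s"
      using s2 z1 by (simp add: power_diff)
    finally have "(\<Sum>r=0..n - s. A s r * w ^ (m * r) / g r * (g r / (p * q ^ (m * r)))) =
       (-1) ^ s * pochhammer (- of_nat n) (2 * s) / fact s * ((2 * X) ^ n / (4 * X\<^sup>2) ^ s) / p *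
       ((1 - z) ^ n / (1 - z) ^ s)" .
    moreover have "- 1 / (X\<^sup>2 * (1 - z)) / 4 = - 1 / (4 * X\<^sup>2 * (1 - z))"
      by simp
    hence "(- 1 / (X\<^sup>2 * (1 - z)) / 4) ^ s = (- 1) ^ s / ((4 * X\<^sup>2) ^ s * (1 - z) ^ s)"
      by (simp only: power_divide power_mult_distrib)
    ultimately show ?thesis
      by (simp add: mult_ac)
  qed
  hence "(\<Sum>s=0..n div 2. \<Sum>r=0..n - s. A s r * w ^ (m * r) / g r * (g r / (p * q ^ (m * r)))) =
      (2 * X) ^ n / p * (1 - z) ^ n *
      hyp_2F0 (- of_nat n / 2) ((- of_nat n + 1) / 2) (- 1 / (X\<^sup>2 * (1 - z)))"
    unfolding hyp_2F0_neg_of_nat sum_distrib_left by (intro sum.cong refl)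
  also have "1 - z = (q ^ m - w ^ m) / q ^ m"
    using q0 by (simp add: z_def diff_divide_distrib)
  also have "- 1 / (X\<^sup>2 * ((q ^ m - w ^ m) / q ^ m)) = - (q ^ m) / (X\<^sup>2 * (q ^ m - w ^ m))"
    by simp
  finally show ?thesis
    using main by (simp add: has_bochner_integral_iff laplace_integrable_def laplace_def
      set_integrable_def set_lebesgue_integral_def p_def)
qed

end
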